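(* For any integer $r \geq 2$, the Diophantine equation $$k \cdot \prod_{j=1}^{r} (x_{j}-1) = \prod_{j=1}^{r} x_{j} - 1, \qquad k \in \mathbb{Z}_{>0},\ x_{j} \in \mathbb{Z}_{>0} \text{ for } 1 \leq j \leq r,$$ in the unknowns $k, x_1, \dots, x_r$ has only finitely many integer solutions with $x_1, \dots, x_r \geq 2$, and these solutions can be explicitly computed (i.e. there is an algorithm which, given $r$, outputs in finite time the complete list of these solutions). *)

theory Defs
  imports Complex_Main "HOL-Library.Nat_Bijection"
begin

section \<open>The Diophantine equation\<close>

text \<open>
  A tuple \<open>(x\<^sub>1, \<dots>, x\<^sub>r)\<close> of positive integers is a list of length \<open>r\<close>, so
  \<open>x\<^sub>j\<close> is \<open>xs ! (j - 1)\<close>. The equation itself is read in the integers,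
  so no subtraction is truncated.
\<close>

definition dioph_solutions :: "nat \<Rightarrow> (nat \<times> nat list) set" where
  "dioph_solutions r =
     {(k, xs). length xs = r \<and> 0 < k \<and> (\<forall>j<r. 0 < xs ! j) \<and>
        int k * (\<Prod>j<r. (int (xs ! j) - 1)) = (\<Prod>j<r. int (xs ! j)) - 1}"

definition dioph_solutions_ge2 :: "nat \<Rightarrow> (nat \<times> nat list) set" where
  "dioph_solutions_ge2 r = {(k, xs) \<in> dioph_solutions r. \<forall>j<r. 2 \<le> xs ! j}"


section \<open>Algorithms: partial recursive functions\<close>

text \<open>
  Programs for Kleene's partial (mu-)recursive functions: zero, successor, projections,
  composition, primitive recursion (on the first argument) and unbounded minimisation
  (over the first argument).
\<close>

datatype recf =
    Zero
  | Succ
  | Proj nat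
  | Comp recf "recf list"
  | PrimRec recf recf
  | Mu recf

text \<open>
  \<open>recf_eval p xs y\<close>: program \<open>p\<close> on the inputs \<open>xs\<close> halts with output \<open>y\<close>.
  There is no \<open>y\<close> when \<open>p\<close> diverges or is applied to the wrong number of inputs.
\<close>

inductive recf_eval :: "recf \<Rightarrow> nat list \<Rightarrow> nat \<Rightarrow> bool" where
  Zero: "recf_eval Zero xs 0"
| Succ: "recf_eval Succ [x] (Suc x)"
| Proj: "i < length xs \<Longrightarrow> recf_eval (Proj i) xs (xs ! i)"
| Comp: "list_all2 (\<lambda>g y. recf_eval g xs y) gs ys \<Longrightarrow> recf_eval f ys z \<Longrightarrow>
         recf_eval (Comp f gs) xs z"
| PrimRec_0: "recf_eval f xs y \<Longrightarrow> recf_eval (PrimRec f g) (0 # xs) y"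
| PrimRec_Suc: "recf_eval (PrimRec f g) (n # xs) y \<Longrightarrow> recf_eval g (n # y # xs) z \<Longrightarrow>
         recf_eval (PrimRec f g) (Suc n # xs) z"
| Mu: "recf_eval f (n # xs) 0 \<Longrightarrow> \<forall>m<n. \<exists>y>0. recf_eval f (m # xs) y \<Longrightarrow>
         recf_eval (Mu f) xs n"

lemma recf_eval_deterministic:
  "recf_eval p xs y \<Longrightarrow> recf_eval p xs z \<Longrightarrow> y = z"
proof (induction p xs y arbitrary: z rule: recf_eval.induct)
  case (Zero xs)
  then show ?case by (auto elim: recf_eval.cases)
next
  case (Succ x)
  then show ?case by (auto elim: recf_eval.cases)
next
  case (Proj i xs)
  then show ?case by (auto elim: recf_eval.cases)
next
  case (Comp xs gs ys f y)
  from Comp.prems obtain zs where zs: "list_all2 (\<lambda>g y. recf_eval g xs y) gs zs" "recf_eval f zs z"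
    by (auto elim: recf_eval.cases)
  have "ys = zs"
    using Comp.IH(1) zs(1) by (auto simp: list_all2_conv_all_nth intro!: nth_equalityI)
  with Comp.IH(2) zs(2) show ?case by blast
next
  case (PrimRec_0 f xs y g)
  from PrimRec_0.prems PrimRec_0.IH show ?case by (auto elim: recf_eval.cases)
next
  case (PrimRec_Suc f g n xs y w)
  from PrimRec_Suc.prems obtain u
    where "recf_eval (PrimRec f g) (n # xs) u" "recf_eval g (n # u # xs) z"
    by (auto elim: recf_eval.cases)
  with PrimRec_Suc.IH show ?case by blast
next
  case (Mu f n xs)
  from Mu.prems have z: "recf_eval f (z # xs) 0" "\<forall>m<z. \<exists>y>0. recf_eval f (m # xs) y"
    by (auto elim: recf_eval.cases)
  show ?case
  proof (rule linorder_cases[of n z])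
    assume "n < z"
    then obtain y where "y > 0" "recf_eval f (n # xs) y" using z(2) by blast
    with Mu.IH(1) show ?thesis by fastforce
  next
    assume "z < n"
    with Mu.IH(2) z(1) show ?thesis by fastforce
  qed
qed

text \<open>
  Outputs are natural numbers; a finite list of pairs \<open>(k, xs)\<close> is read off from such a
  number via the standard bijections of \<^theory>\<open>HOL-Library.Nat_Bijection\<close>.
\<close>

definition decode_solution :: "nat \<Rightarrow> nat \<times> nat list" where
  "decode_solution n = (case prod_decode n of (k, c) \<Rightarrow> (k, list_decode c))"

definition decode_output :: "nat \<Rightarrow> (nat \<times> nat list) list" where
  "decode_output n = map decode_solution (list_decode n)"

end

theory Submission imports Defs "HOL-Library.Multiset" begin

text \<open>
  \<^bold>\<open>Finiteness.\<close> Sort a solution as \<open>y\<^sub>1 \<le> \<dots> \<le> y\<^sub>r\<close> and absorb the first \<open>i\<close> entries into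
  coefficients: with \<open>a = k (y\<^sub>1 - 1) \<cdots> (y\<^sub>i - 1)\<close> and \<open>B = y\<^sub>1 \<cdots> y\<^sub>i\<close> the remaining \<open>m = r - i\<close>
  entries satisfy \<open>B \<Prod> y\<^sub>j = a \<Prod> (y\<^sub>j - 1) + 1\<close>. If \<open>a \<le> B\<close>, then
  \<open>B (\<Prod> y\<^sub>j - \<Prod> (y\<^sub>j - 1)) \<le> 1\<close>; but the left-hand side is at least \<open>B m\<close>, and \<open>B m \<ge> 2\<close> because
  \<open>m = r \<ge> 2\<close> at the start and \<open>B \<ge> y\<^sub>1 \<ge> 2\<close> afterwards. So
  \<open>a \<ge> B + 1\<close>, which says that \<open>\<Prod> (1 - 1/y\<^sub>j) < B / (B + 1)\<close>. As that product is at least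
  \<open>1 - m/y\<close> for the smallest remaining entry \<open>y\<close>, one gets \<open>y < m (B + 1)\<close>: once the earlier entries
  are known, the next one is bounded. Hence each step replaces \<open>B\<close> by at most \<open>r B (B + 1)\<close>, and
  iterating this \<open>r\<close> times from \<open>1\<close> bounds \<open>\<Prod> x\<^sub>j\<close>, every \<open>x\<^sub>j\<close> and \<open>k\<close>
  (\<open>product_le_iterated_growth\<close>, \<open>solution_bounds\<close>).

  \<^bold>\<open>Algorithm.\<close> The bound above is a primitive recursive function of \<open>r\<close>, and since the pairing and
  list codings are monotone it turns into a bound \<open>code_bound r\<close> on the codes of solutions. The
  program runs through all codes below it, decodes each one, tests the equation, and conses the
  successful codes to the output (\<open>solution_codes\<close>). All of this is primitive recursive, so it
  suffices to prove closure of the computable functions under substitution and primitive recursion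
  and to check each ingredient, down to the decoding of pairs (\<open>prod_diag_Suc\<close>).
\<close>

section \<open>An explicit bound for the solutions\<close>

text \<open>
  Cleared of denominators, the Weierstrass product inequality
  \<open>\<Prod> (1 - 1/y\<^sub>j) \<ge> 1 - \<Sum> 1/y\<^sub>j\<close> with every \<open>1/y\<^sub>j\<close> replaced by the larger \<open>1/y\<close>.
\<close>

lemma weierstrass_product_nat:
  fixes y :: nat
  assumes "\<forall>z\<in>set ys. y \<le> z \<and> 1 \<le> z"
  shows "y * prod_list ys \<le> y * prod_list (map (\<lambda>z. z - 1) ys) + length ys * prod_list ys"
  using assms
proof (induction ys)
  case (Cons z ys)
  let ?P = "prod_list ys" and ?Q = "prod_list (map (\<lambda>z. z - 1) ys)"
  obtain w where w: "z = Suc w" using Cons.prems by (cases z) auto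
  have IH: "y * ?P \<le> y * ?Q + length ys * ?P" using Cons by auto
  have "y * (z * ?P) = w * (y * ?P) + y * ?P" by (simp add: w algebra_simps)
  also have "\<dots> \<le> w * (y * ?Q + length ys * ?P) + z * ?P"
    using Cons.prems by (intro add_mono mult_le_mono IH) auto
  also have "\<dots> \<le> y * (w * ?Q) + Suc (length ys) * (z * ?P)"
    by (simp add: w algebra_simps)
  finally show ?case by (simp add: w)
qed simp

lemma prod_list_pos_nat: "\<forall>z\<in>set ys. 1 \<le> z \<Longrightarrow> 1 \<le> prod_list (ys :: nat list)"
  by (induction ys) (auto simp: Suc_le_eq)

lemma prod_list_decrement_gap:
  fixes ys :: "nat list"
  assumes "\<forall>z\<in>set ys. 2 \<le> z"
  shows "prod_list (map (\<lambda>z. z - 1) ys) + length ys \<le> prod_list ys"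
  using assms
proof (induction ys)
  case (Cons z ys)
  let ?P = "prod_list ys" and ?Q = "prod_list (map (\<lambda>z. z - 1) ys)"
  obtain v where v: "z = v + 2" using Cons.prems by (metis add.commute le_Suc_ex list.set_intros(1))
  have IH: "?Q + length ys \<le> ?P" using Cons by auto
  have "1 \<le> ?P" using Cons.prems by (intro prod_list_pos_nat) fastforce
  moreover have "v * ?Q \<le> v * ?P" using IH by (intro mult_le_mono) auto
  moreover have "prod_list (map (\<lambda>z. z - 1) (z # ys)) = v * ?Q + ?Q"
    "prod_list (z # ys) = v * ?P + 2 * ?P"
    by (simp_all add: v distrib_right)
  ultimately show ?case using IH unfolding list.size by linarith
qed simp

text \<open>
  For nonempty \<open>ys\<close> the side condition \<open>2 \<le> B * length ys\<close> excludes exactly the degenerate family \<open>B = 1\<close>,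
  \<open>ys = [y]\<close>, \<open>a = 1\<close>, in which \<open>y\<close> is arbitrary.
\<close>

lemma least_entry_bound:
  fixes a B :: nat
  assumes eq: "B * prod_list ys = a * prod_list (map (\<lambda>z. z - 1) ys) + 1"
    and ge2: "\<forall>z\<in>set ys. 2 \<le> z" and least: "\<forall>z\<in>set ys. y \<le> z"
    and nondeg: "2 \<le> B * length ys"
  shows "y < length ys * (B + 1)"
proof -
  let ?P = "prod_list ys" and ?Q = "prod_list (map (\<lambda>z. z - 1) ys)"
  have aB: "B + 1 \<le> a"
  proof (rule ccontr)
    assume "\<not> B + 1 \<le> a"
    then have "a * ?Q \<le> B * ?Q" by (intro mult_le_mono) auto
    moreover have "B * (?Q + length ys) \<le> B * ?P"
      using prod_list_decrement_gap[OF ge2] by (intro mult_le_mono) auto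
    ultimately show False using eq nondeg unfolding distrib_left by linarith
  qed
  have W: "y * ?P \<le> y * ?Q + length ys * ?P"
    using ge2 least by (intro weierstrass_product_nat) fastforce
  show ?thesis
  proof (rule ccontr)
    assume "\<not> ?thesis"
    then have y: "length ys * (B + 1) \<le> y" by simp
    have "length ys \<noteq> 0" using nondeg by (intro notI) simp
    then have "1 \<le> y" using y by (cases y) auto
    have "y * (B * ?P) + y * ?P \<le> (B + 1) * (y * ?Q) + length ys * (B + 1) * ?P"
      using mult_le_mono[OF order_refl W, of "B + 1"] by (simp add: algebra_simps)
    also have "\<dots> \<le> a * (y * ?Q) + y * ?P"
      by (intro add_mono mult_le_mono aB y order_refl)
    finally have "y * (B * ?P) \<le> y * (a * ?Q)" by (simp add: algebra_simps)
    then show False using eq \<open>1 \<le> y\<close> by simp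
  qed
qed

definition growth :: "nat \<Rightarrow> nat \<Rightarrow> nat" where
  "growth r b = r * (b * (b + 1))"

lemma growth_iterate_mono: "b \<le> b' \<Longrightarrow> (growth r ^^ n) b \<le> (growth r ^^ n) b'"
proof (rule funpow_mono)
  show "mono (growth r)" unfolding growth_def by (intro monoI mult_le_mono) auto
qed

text \<open>
  The general coefficients \<open>a\<close> and \<open>B\<close> make the statement inductive: removing the least entry \<open>y\<close>
  turns \<open>(a, B)\<close> into \<open>(a * (y - 1), B * y)\<close>. After that \<open>B \<ge> 2\<close>, so the nondegeneracy
  condition can fail only for the empty list.
\<close>

lemma product_le_iterated_growth:
  fixes a B :: nat
  assumes "sorted ys" "\<forall>z\<in>set ys. 2 \<le> z" "length ys \<le> r"
    and "1 \<le> B" "ys = [] \<or> 2 \<le> B * length ys"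
    and "B * prod_list ys = a * prod_list (map (\<lambda>z. z - 1) ys) + 1"
  shows "B * prod_list ys \<le> (growth r ^^ length ys) B"
  using assms
proof (induction ys arbitrary: a B)
  case (Cons y ys)
  have "y < length (y # ys) * (B + 1)"
    using Cons.prems by (intro least_entry_bound[where a = a]) auto
  also have "\<dots> \<le> r * (B + 1)" using Cons.prems by (intro mult_le_mono) auto
  finally have "B * y \<le> B * (r * (B + 1))" by (intro mult_le_mono) auto
  then have step: "B * y \<le> growth r B" by (simp add: growth_def algebra_simps)
  have By: "2 \<le> B * y" using Cons.prems mult_le_mono[of 1 B 2 y] by simp
  have "(B * y) * prod_list ys \<le> (growth r ^^ length ys) (B * y)"
  proof (rule Cons.IH)
    show "ys = [] \<or> 2 \<le> B * y * length ys"
      using By mult_le_mono[of 2 "B * y" 1 "length ys"] by (cases ys) auto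
    show "B * y * prod_list ys = (a * (y - 1)) * prod_list (map (\<lambda>z. z - 1) ys) + 1"
      using Cons.prems by (simp add: mult.assoc)
  qed (use Cons.prems By in auto)
  also have "\<dots> \<le> (growth r ^^ length ys) (growth r B)"
    by (intro growth_iterate_mono step)
  finally show ?case by (simp add: mult.assoc funpow_swap1)
qed simp

definition product_bound :: "nat \<Rightarrow> nat" where
  "product_bound r = (growth r ^^ r) 1"

text \<open>
  Over the natural numbers the equation reads \<open>\<Prod> x = k * \<Prod> (x - 1) + 1\<close>; the subtractions do
  not truncate, since \<open>x \<ge> 2\<close>. Positivity of \<open>k\<close> is automatic: \<open>k = 0\<close> would force \<open>\<Prod> x = 1\<close>.
\<close>

lemma mem_dioph_solutions_ge2_iff:
  assumes "1 \<le> r"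
  shows "(k, xs) \<in> dioph_solutions_ge2 r \<longleftrightarrow>
    length xs = r \<and> (\<forall>x\<in>set xs. 2 \<le> x) \<and>
    prod_list xs = k * prod_list (map (\<lambda>x. x - 1) xs) + 1"
proof (cases "length xs = r \<and> (\<forall>x\<in>set xs. 2 \<le> x)")
  case True
  then have len: "length xs = r" and ge2: "\<forall>x\<in>set xs. 2 \<le> x" by auto
  let ?P = "prod_list xs" and ?Q = "prod_list (map (\<lambda>x. x - 1) xs)"
  have nth2: "2 \<le> xs ! j" if "j < r" for j using that ge2 len by auto
  have P: "(\<Prod>j<r. int (xs ! j)) = int ?P"
    by (simp add: prod.list_conv_set_nth len atLeast0LessThan)
  have "(\<Prod>j<r. int (xs ! j) - 1) = (\<Prod>j<r. int (xs ! j - 1))"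
  proof (intro prod.cong refl)
    fix j assume "j \<in> {..<r}"
    then show "int (xs ! j) - 1 = int (xs ! j - 1)" using nth2[of j] by auto
  qed
  also have "\<dots> = int ?Q"
    by (simp add: prod.list_conv_set_nth len atLeast0LessThan)
  finally have Q: "(\<Prod>j<r. int (xs ! j) - 1) = int ?Q" .
  have "int k * int ?Q = int ?P - 1 \<longleftrightarrow> int ?P = int (k * ?Q + 1)" by auto
  then have eq: "int k * int ?Q = int ?P - 1 \<longleftrightarrow> ?P = k * ?Q + 1"
    by (simp only: of_nat_eq_iff)
  have "1 < ?P"
    using prod_list_decrement_gap[OF ge2] prod_list_pos_nat[of "map (\<lambda>x. x - 1) xs"] ge2 len assms
    by fastforce
  then have k: "0 < k" if "?P = k * ?Q + 1" using that by (cases k) auto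
  have "\<forall>j<r. 0 < xs ! j" using nth2 by fastforce
  then have "(k, xs) \<in> dioph_solutions_ge2 r \<longleftrightarrow> 0 < k \<and> int k * int ?Q = int ?P - 1"
    using nth2 len by (simp add: dioph_solutions_ge2_def dioph_solutions_def P Q)
  then show ?thesis using True k eq by blast
next
  case False
  then show ?thesis
    by (auto simp: dioph_solutions_ge2_def dioph_solutions_def in_set_conv_nth)
qed

lemma member_le_prod_list_nat:
  "\<forall>z\<in>set ys. 1 \<le> z \<Longrightarrow> y \<in> set ys \<Longrightarrow> y \<le> prod_list (ys :: nat list)"
  by (intro dvd_imp_le prod_list_dvd) (use prod_list_pos_nat[of ys] in auto)

lemma solution_bounds:
  assumes r: "2 \<le> r" and sol: "(k, xs) \<in> dioph_solutions_ge2 r"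
  shows "k \<le> product_bound r" and "\<forall>x\<in>set xs. x \<le> product_bound r"
proof -
  let ?Q = "prod_list (map (\<lambda>x. x - 1) xs)"
  have len: "length xs = r" and ge2: "\<forall>x\<in>set xs. 2 \<le> x"
    and eq: "prod_list xs = k * ?Q + 1"
    using sol r by (auto simp: mem_dioph_solutions_ge2_iff)
  have ge1: "\<forall>x\<in>set xs. 1 \<le> x" using ge2 by fastforce
  have sort_prod: "prod_list (sort xs) = prod_list xs"
    "prod_list (map (\<lambda>x. x - 1) (sort xs)) = ?Q"
    by (metis mset_sort mset_map prod_mset_prod_list)+
  have "1 * prod_list (sort xs) \<le> (growth r ^^ length (sort xs)) 1"
    using r len ge2 eq
    by (intro product_le_iterated_growth[where a = k]) (auto simp: sort_prod simp del: One_nat_def)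
  then have bound: "prod_list xs \<le> product_bound r"
    by (simp add: sort_prod len product_bound_def)
  show "\<forall>x\<in>set xs. x \<le> product_bound r"
    using member_le_prod_list_nat[OF ge1] bound order_trans by blast
  have "1 \<le> ?Q" using ge2 by (intro prod_list_pos_nat) fastforce
  then have "k \<le> k * ?Q" by simp
  then show "k \<le> product_bound r" using eq bound by linarith
qed


section \<open>Codes of solutions\<close>

lemma triangle_mono: "m \<le> n \<Longrightarrow> triangle m \<le> triangle n"
  by (induction rule: dec_induct) auto

lemma prod_encode_mono: "a \<le> a' \<Longrightarrow> b \<le> b' \<Longrightarrow> prod_encode (a, b) \<le> prod_encode (a', b')"
  unfolding prod_encode_def split by (intro add_mono triangle_mono)

lemma list_encode_le_replicate:
  "\<forall>x\<in>set xs. x \<le> b \<Longrightarrow> list_encode xs \<le> list_encode (replicate (length xs) b)"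
  by (induction xs) (auto intro: prod_encode_mono)

definition code_bound :: "nat \<Rightarrow> nat" where
  "code_bound r =
     Suc (prod_encode (product_bound r, list_encode (replicate r (product_bound r))))"

lemma decode_solution_encode: "decode_solution (prod_encode (k, list_encode xs)) = (k, xs)"
  by (simp add: decode_solution_def)

lemma inj_decode_solution: "inj decode_solution"
proof (rule injI)
  fix c d
  assume "decode_solution c = decode_solution d"
  then show "c = d"
    by (auto simp: decode_solution_def list_decode_eq split: prod.splits)
      (metis prod_decode_inverse)
qed

lemma solution_has_small_code:
  assumes "2 \<le> r" "s \<in> dioph_solutions_ge2 r"
  shows "\<exists>c < code_bound r. decode_solution c = s"
proof -
  obtain k xs where s: "s = (k, xs)" by fastforce
  have "length xs = r" using assms by (simp add: s mem_dioph_solutions_ge2_iff)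
  then have "list_encode xs \<le> list_encode (replicate r (product_bound r))"
    using solution_bounds(2)[OF assms(1)] assms(2) list_encode_le_replicate s by blast
  then have "prod_encode (k, list_encode xs) < code_bound r"
    unfolding code_bound_def less_Suc_eq_le
    using solution_bounds(1)[OF assms(1)] assms(2) s by (intro prod_encode_mono) auto
  then show ?thesis using decode_solution_encode s by blast
qed

text \<open>
  Head and tail of a coded list. On the code \<open>0\<close> of the empty list both return \<open>0\<close>, because
  \<open>prod_decode 0 = (0, 0)\<close>; so entries past the end read as \<open>0\<close>, which is never a legal entry.
\<close>

definition code_hd :: "nat \<Rightarrow> nat" where
  "code_hd c = fst (prod_decode (c - 1))"

definition code_tl :: "nat \<Rightarrow> nat" where
  "code_tl c = snd (prod_decode (c - 1))"

definition code_nth :: "nat \<Rightarrow> nat \<Rightarrow> nat" where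
  "code_nth j c = code_hd ((code_tl ^^ j) c)"

lemma prod_decode_0: "prod_decode 0 = (0, 0)"
  by (simp add: prod_decode_def prod_decode_aux.simps)

lemma code_tl_list_encode: "code_tl (list_encode xs) = list_encode (tl xs)"
  by (cases xs) (simp_all add: code_tl_def prod_decode_0)

lemma code_tl_iterate: "(code_tl ^^ j) (list_encode xs) = list_encode (drop j xs)"
  by (induction j) (simp_all add: code_tl_list_encode drop_Suc tl_drop)

lemma code_nth_list_encode:
  "code_nth j (list_encode xs) = (if j < length xs then xs ! j else 0)"
proof (cases "drop j xs")
  case Nil
  then show ?thesis by (simp add: code_nth_def code_tl_iterate code_hd_def prod_decode_0)
next
  case (Cons y ys)
  then have "j < length xs" "xs ! j = y"
    by (metis drop_all list.distinct(1) not_le,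
        metis hd_drop_conv_nth list.sel(1) drop_all list.distinct(1) not_le)
  then show ?thesis by (simp add: code_nth_def code_tl_iterate code_hd_def Cons)
qed

text \<open>
  Vanishes exactly on the codes of solutions. The first summand says that the coded list \<open>l\<close> has at
  most \<open>r\<close> entries. The second one says that the truncated product \<open>\<Prod> (x\<^sub>j - 1)\<close> over \<open>j < r\<close> is
  nonzero, that is, all these entries are at least \<open>2\<close>, and therefore also that none is missing.
  The last two summands form the distance between the two sides of the equation.
\<close>

definition solution_defect :: "nat \<Rightarrow> nat \<Rightarrow> nat" where
  "solution_defect r c =
     (let k = fst (prod_decode c); l = snd (prod_decode c);
          P = (\<Prod>j<r. code_nth j l); Q = (\<Prod>j<r. code_nth j l - 1)
      in (code_tl ^^ r) l + (1 - Q) + ((P - (k * Q + 1)) + ((k * Q + 1) - P)))"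

lemma list_encode_eq_0_iff: "list_encode xs = 0 \<longleftrightarrow> xs = []"
  by (cases xs) auto

lemma solution_defect_eq_0_iff:
  assumes "2 \<le> r"
  shows "solution_defect r c = 0 \<longleftrightarrow> decode_solution c \<in> dioph_solutions_ge2 r"
proof -
  obtain k xs where dec: "decode_solution c = (k, xs)" by fastforce
  then have kl: "fst (prod_decode c) = k" "snd (prod_decode c) = list_encode xs"
    by (auto simp: decode_solution_def split: prod.splits)
  let ?P = "\<Prod>j<r. code_nth j (list_encode xs)"
  let ?Q = "\<Prod>j<r. code_nth j (list_encode xs) - 1"
  have "?Q \<noteq> 0 \<longleftrightarrow> (\<forall>j<r. 2 \<le> code_nth j (list_encode xs))"
    by (auto simp: not_le less_Suc_eq_le numeral_2_eq_2 Suc_le_eq)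
  also have "\<dots> \<longleftrightarrow> r \<le> length xs \<and> (\<forall>j<r. 2 \<le> xs ! j)"
  proof (cases "r \<le> length xs")
    case False
    then have "length xs < r" "code_nth (length xs) (list_encode xs) = 0"
      by (simp_all add: code_nth_list_encode)
    then show ?thesis using False by fastforce
  qed (simp add: code_nth_list_encode)
  finally have "?Q \<noteq> 0 \<longleftrightarrow> r \<le> length xs \<and> (\<forall>j<r. 2 \<le> xs ! j)" .
  then have legal: "drop r xs = [] \<and> ?Q \<noteq> 0 \<longleftrightarrow> length xs = r \<and> (\<forall>x\<in>set xs. 2 \<le> x)"
    by (auto simp: all_set_conv_all_nth)
  have prods: "?P = prod_list xs" "?Q = prod_list (map (\<lambda>x. x - 1) xs)" if "length xs = r"
    using that by (simp_all add: code_nth_list_encode prod.list_conv_set_nth atLeast0LessThan)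
  have "solution_defect r c = 0 \<longleftrightarrow> (drop r xs = [] \<and> ?Q \<noteq> 0) \<and> ?P = k * ?Q + 1"
  proof -
    have "t + (1 - q) + ((p - e) + (e - p)) = 0 \<longleftrightarrow> (t = 0 \<and> q \<noteq> 0) \<and> p = e"
      for t q p e :: nat by auto
    then show ?thesis
      unfolding solution_defect_def kl Let_def code_tl_iterate
      by (simp only: list_encode_eq_0_iff)
  qed
  also have "\<dots> \<longleftrightarrow> (k, xs) \<in> dioph_solutions_ge2 r"
    unfolding legal using assms prods by (auto simp: mem_dioph_solutions_ge2_iff)
  finally show ?thesis by (simp add: dec)
qed

primrec solution_codes :: "nat \<Rightarrow> nat \<Rightarrow> nat" where
  "solution_codes 0 r = 0"
| "solution_codes (Suc c) r =
     (if solution_defect r c = 0 then Suc (prod_encode (c, solution_codes c r))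
      else solution_codes c r)"

lemma list_decode_solution_codes:
  "list_decode (solution_codes n r) = rev (filter (\<lambda>c. solution_defect r c = 0) [0..<n])"
  by (induction n) auto

lemma decode_output_solution_codes:
  assumes "2 \<le> r"
  defines "out \<equiv> solution_codes (code_bound r) r"
  shows "distinct (decode_output out)" and "set (decode_output out) = dioph_solutions_ge2 r"
proof -
  show "distinct (decode_output out)"
    unfolding decode_output_def out_def list_decode_solution_codes
    by (simp add: distinct_map inj_on_subset[OF inj_decode_solution])
  have "set (decode_output out) =
      decode_solution ` {c. c < code_bound r \<and> decode_solution c \<in> dioph_solutions_ge2 r}"
    unfolding decode_output_def out_def list_decode_solution_codes
    by (auto simp: solution_defect_eq_0_iff[OF assms(1)])
  also have "\<dots> = dioph_solutions_ge2 r"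
    using solution_has_small_code[OF assms(1)] by blast
  finally show "set (decode_output out) = dioph_solutions_ge2 r" .
qed


section \<open>Closure properties of the computable functions\<close>

definition computable :: "nat \<Rightarrow> (nat list \<Rightarrow> nat) \<Rightarrow> bool" where
  "computable n f \<longleftrightarrow> (\<exists>p. \<forall>xs. length xs = n \<longrightarrow> recf_eval p xs (f xs))"

abbreviation computable1 :: "(nat \<Rightarrow> nat) \<Rightarrow> bool" where
  "computable1 f \<equiv> computable 1 (\<lambda>xs. f (xs ! 0))"

abbreviation computable2 :: "(nat \<Rightarrow> nat \<Rightarrow> nat) \<Rightarrow> bool" where
  "computable2 f \<equiv> computable 2 (\<lambda>xs. f (xs ! 0) (xs ! 1))"

abbreviation computable3 :: "(nat \<Rightarrow> nat \<Rightarrow> nat \<Rightarrow> nat) \<Rightarrow> bool" where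
  "computable3 f \<equiv> computable 3 (\<lambda>xs. f (xs ! 0) (xs ! 1) (xs ! 2))"

lemma computable_subst:
  assumes f: "computable (length gs) f" and gs: "\<forall>g\<in>set gs. computable n g"
  shows "computable n (\<lambda>xs. f (map (\<lambda>g. g xs) gs))"
proof -
  obtain p where p: "\<And>ys. length ys = length gs \<Longrightarrow> recf_eval p ys (f ys)"
    using f unfolding computable_def by blast
  obtain q where q: "\<And>g xs. g \<in> set gs \<Longrightarrow> length xs = n \<Longrightarrow> recf_eval (q g) xs (g xs)"
    using gs unfolding computable_def by metis
  have "recf_eval (Comp p (map q gs)) xs (f (map (\<lambda>g. g xs) gs))" if "length xs = n" for xs
    using that by (intro recf_eval.Comp[where ys = "map (\<lambda>g. g xs) gs"] p) (auto simp: list_all2_conv_all_nth intro!: q)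
  then show ?thesis unfolding computable_def by blast
qed

lemma computable_compose1:
  "computable1 f \<Longrightarrow> computable n a \<Longrightarrow> computable n (\<lambda>xs. f (a xs))"
  using computable_subst[of "[a]" "\<lambda>xs. f (xs ! 0)" n] by simp

lemma computable_compose2:
  "computable2 f \<Longrightarrow> computable n a \<Longrightarrow> computable n b \<Longrightarrow> computable n (\<lambda>xs. f (a xs) (b xs))"
  using computable_subst[of "[a, b]" "\<lambda>xs. f (xs ! 0) (xs ! 1)" n]
  by (simp add: numeral_2_eq_2)

lemma computable_primrec:
  assumes base: "computable1 b" and step: "computable3 s"
    and f0: "\<And>a. f 0 a = b a" and fS: "\<And>m a. f (Suc m) a = s m (f m a) a"
  shows "computable2 f"
proof -
  obtain p where p: "\<And>xs. length xs = 1 \<Longrightarrow> recf_eval p xs (b (xs ! 0))"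
    using base unfolding computable_def by blast
  obtain q where q: "\<And>xs. length xs = 3 \<Longrightarrow> recf_eval q xs (s (xs ! 0) (xs ! 1) (xs ! 2))"
    using step unfolding computable_def by blast
  have "recf_eval (PrimRec p q) [m, a] (f m a)" for m a
  proof (induction m)
    case 0
    show ?case using p[of "[a]"] by (auto simp: f0 intro: recf_eval.PrimRec_0)
  next
    case (Suc m)
    then show ?case
      using q[of "[m, f m a, a]"] by (auto simp: fS intro: recf_eval.PrimRec_Suc)
  qed
  then have "recf_eval (PrimRec p q) xs (f (xs ! 0) (xs ! 1))" if "length xs = 2" for xs
    using that by (auto simp: length_Suc_conv numeral_2_eq_2)
  then show ?thesis unfolding computable_def by blast
qed

lemma computable_nth: "i < n \<Longrightarrow> computable n (\<lambda>xs. xs ! i)"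
  unfolding computable_def by (auto intro: recf_eval.Proj)

lemma computable_Suc:
  assumes "computable n a" shows "computable n (\<lambda>xs. Suc (a xs))"
proof (rule computable_compose1[OF _ assms])
  have "recf_eval Succ xs (Suc (xs ! 0))" if "length xs = 1" for xs
    using that by (auto simp: length_Suc_conv intro: recf_eval.Succ)
  then show "computable1 Suc" unfolding computable_def by blast
qed

lemma computable_const: "computable n (\<lambda>_. c)"
proof (induction c)
  case 0
  show ?case unfolding computable_def using recf_eval.Zero by blast
qed (rule computable_Suc)

lemmas computable_basic = computable_nth computable_Suc computable_const


section \<open>The algorithm is computable\<close>

lemma computable_add:
  assumes "computable n a" "computable n b"
  shows "computable n (\<lambda>xs. a xs + b xs)"
proof (rule computable_compose2[OF _ assms])
  show "computable2 (+)"
    by (rule computable_primrec[where b = "\<lambda>a. a" and s = "\<lambda>m y a. Suc y"];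
      (intro computable_basic)?; simp)
qed

lemma computable_mult:
  assumes "computable n a" "computable n b"
  shows "computable n (\<lambda>xs. a xs * b xs)"
proof (rule computable_compose2[OF _ assms])
  show "computable2 (*)"
    by (rule computable_primrec[where b = "\<lambda>a. 0" and s = "\<lambda>m y a. a + y"];
      (intro computable_basic computable_add)?; simp)
qed

lemma computable_diff:
  assumes "computable n a" "computable n b"
  shows "computable n (\<lambda>xs. a xs - b xs)"
proof -
  have "computable2 (\<lambda>m _. m - 1)"
    by (rule computable_primrec[where b = "\<lambda>a. 0" and s = "\<lambda>m y a. m"];
      (intro computable_basic)?; simp)
  then have pred: "computable k a \<Longrightarrow> computable k (\<lambda>xs. a xs - 1)" for k a
    by (rule computable_compose2[where b = a])
  \<comment> \<open>Recursion runs over the first argument, so the subtrahend comes first.\<close>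
  have "computable2 (\<lambda>m a. a - m)"
    by (rule computable_primrec[where b = "\<lambda>a. a" and s = "\<lambda>m y a. y - 1"];
      (intro computable_basic pred)?; simp)
  from computable_compose2[OF this assms(2) assms(1)] show ?thesis .
qed

lemmas computable_arith = computable_basic computable_add computable_mult computable_diff

lemma computable_if_zero:
  assumes "computable n t" "computable n a" "computable n b"
  shows "computable n (\<lambda>xs. if t xs = 0 then a xs else b xs)"
proof -
  have "(\<lambda>xs. if t xs = 0 then a xs else b xs) =
      (\<lambda>xs. (1 - t xs) * a xs + (1 - (1 - t xs)) * b xs)"
    by auto
  then show ?thesis by (simp only:) (intro computable_arith assms)
qed

lemma computable_prod:
  assumes "computable2 h" shows "computable2 (\<lambda>i c. \<Prod>j<i. h j c)"
  by (rule computable_primrec[where b = "\<lambda>_. 1" and s = "\<lambda>j y c. y * h j c"];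
      (intro computable_arith computable_compose2[OF assms])?; simp)

lemma computable_funpow:
  assumes "computable2 h" "computable1 b" shows "computable2 (\<lambda>i c. (h c ^^ i) (b c))"
  by (rule computable_primrec[where b = b and s = "\<lambda>_ y c. h c y"];
      (intro computable_basic computable_compose2[OF assms(1)] assms(2))?; simp)

lemma computable_triangle:
  assumes "computable n a" shows "computable n (\<lambda>xs. triangle (a xs))"
proof -
  have "computable2 (\<lambda>m _. triangle m)"
    by (rule computable_primrec[where b = "\<lambda>_. 0" and s = "\<lambda>m y _. y + Suc m"];
      (intro computable_arith)?; simp)
  from computable_compose2[OF this assms assms] show ?thesis .
qed

lemma computable_prod_encode:
  "computable n a \<Longrightarrow> computable n b \<Longrightarrow> computable n (\<lambda>xs. prod_encode (a xs, b xs))"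
  unfolding prod_encode_def split by (intro computable_arith computable_triangle)

text \<open>
  The pairing function enumerates the pairs diagonal by diagonal. The index \<open>x + y\<close> of the diagonal
  is a single number that determines the pair together with its code, so, unlike the pair itself,
  it can be carried along a primitive recursion.
\<close>

definition prod_diag :: "nat \<Rightarrow> nat" where
  "prod_diag n = fst (prod_decode n) + snd (prod_decode n)"

lemma prod_code_position:
  assumes "prod_decode n = (a, b)" shows "n = triangle (a + b) + a"
  using prod_decode_inverse[of n] by (simp add: assms prod_encode_def)

lemma prod_decode_eq_diag:
  "fst (prod_decode n) = n - triangle (prod_diag n)"
  "snd (prod_decode n) = prod_diag n - (n - triangle (prod_diag n))"
proof -
  obtain a b where ab: "prod_decode n = (a, b)" by fastforce
  have diag: "prod_diag n = a + b" by (simp add: prod_diag_def ab)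
  have "n - triangle (prod_diag n) = a"
    unfolding diag using prod_code_position[OF ab] by linarith
  then show "fst (prod_decode n) = n - triangle (prod_diag n)"
    "snd (prod_decode n) = prod_diag n - (n - triangle (prod_diag n))"
    by (simp_all add: diag ab)
qed

lemma prod_diag_Suc:
  "prod_diag (Suc n) =
     (if triangle (Suc (prod_diag n)) - Suc n = 0 then Suc (prod_diag n) else prod_diag n)"
proof -
  obtain a b where ab: "prod_decode n = (a, b)" by fastforce
  have diag: "prod_diag n = a + b" by (simp add: prod_diag_def ab)
  note n = prod_code_position[OF ab]
  show ?thesis
  proof (cases b)
    case 0
    have "Suc n = prod_encode (0, Suc a)" using n by (simp add: 0 prod_encode_def)
    then have "prod_decode (Suc n) = (0, Suc a)" by simp
    then have "prod_diag (Suc n) = Suc a" by (simp add: prod_diag_def)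
    then show ?thesis unfolding diag using n by (simp add: 0)
  next
    case (Suc b')
    have "Suc n = prod_encode (Suc a, b')" using n by (simp add: Suc prod_encode_def)
    then have "prod_decode (Suc n) = (Suc a, b')" by simp
    then have "prod_diag (Suc n) = a + b" by (simp add: prod_diag_def Suc)
    then show ?thesis unfolding diag using n by (simp add: Suc)
  qed
qed

lemma computable_prod_diag:
  assumes "computable n a" shows "computable n (\<lambda>xs. prod_diag (a xs))"
proof -
  have "computable2 (\<lambda>m _. prod_diag m)"
    by (rule computable_primrec[where b = "\<lambda>_. prod_diag 0" and
          s = "\<lambda>m y _. if triangle (Suc y) - Suc m = 0 then Suc y else y"];
      (intro computable_if_zero computable_arith computable_triangle)?; simp add: prod_diag_Suc)
  from computable_compose2[OF this assms assms] show ?thesis .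
qed

lemma computable_prod_decode:
  assumes "computable n a"
  shows "computable n (\<lambda>xs. fst (prod_decode (a xs)))"
    and "computable n (\<lambda>xs. snd (prod_decode (a xs)))"
  unfolding prod_decode_eq_diag
  by (intro computable_arith computable_triangle computable_prod_diag assms)+

lemma computable_code_tl_iterate: "computable2 (\<lambda>i c. (code_tl ^^ i) c)"
proof (rule computable_funpow)
  show "computable2 (\<lambda>_. code_tl)"
    unfolding code_tl_def by (intro computable_prod_decode computable_arith) simp
qed (simp add: computable_nth)

lemma computable_code_nth: "computable2 code_nth"
  unfolding code_nth_def code_hd_def
  by (intro computable_prod_decode computable_diff computable_code_tl_iterate computable_const)

lemma computable_solution_defect: "computable2 solution_defect"
proof -
  have *: "computable2 (\<lambda>j c. code_nth j c - 1)"
    by (intro computable_diff computable_code_nth computable_const)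
  show ?thesis
    unfolding solution_defect_def Let_def
    by (intro computable_arith computable_prod_decode
        computable_compose2[OF computable_code_tl_iterate]
        computable_compose2[OF computable_prod[OF computable_code_nth]]
        computable_compose2[OF computable_prod[OF *]]) simp_all
qed

lemma computable_solution_codes: "computable2 solution_codes"
  by (rule computable_primrec[where b = "\<lambda>_. 0" and
        s = "\<lambda>c y r. if solution_defect r c = 0 then Suc (prod_encode (c, y)) else y"];
      (intro computable_if_zero computable_basic computable_prod_encode
      computable_compose2[OF computable_solution_defect])?; simp)

lemma computable_product_bound: "computable1 product_bound"
proof -
  have "computable2 growth"
    unfolding growth_def by (intro computable_arith) simp_all
  then have "computable2 (\<lambda>i r. (growth r ^^ i) 1)"
    by (rule computable_funpow[where b = "\<lambda>_. 1"]) (rule computable_const)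
  then show ?thesis
    unfolding product_bound_def
    by (rule computable_compose2[where f = "\<lambda>i r. (growth r ^^ i) 1"])
      (simp_all add: computable_nth)
qed

lemma computable_code_bound: "computable1 code_bound"
proof -
  have "computable2 (\<lambda>i b. list_encode (replicate i b))"
    by (rule computable_primrec[where b = "\<lambda>_. 0" and s = "\<lambda>_ y b. Suc (prod_encode (b, y))"];
      (intro computable_basic computable_prod_encode)?; simp)
  note replicate = computable_compose2[OF this]
  show ?thesis
    unfolding code_bound_def
    by (intro computable_Suc computable_prod_encode computable_product_bound replicate computable_nth)
      simp
qed

theorem theorem1p1:
  "(\<forall>r\<ge>2. finite (dioph_solutions_ge2 r)) \<and>
   (\<exists>algo. \<forall>r\<ge>2. \<exists>out. recf_eval algo [r] out \<and>
      distinct (decode_output out) \<and> set (decode_output out) = dioph_solutions_ge2 r)"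
proof (intro conjI allI impI)
  fix r :: nat
  assume "2 \<le> r"
  then show "finite (dioph_solutions_ge2 r)"
    by (metis List.finite_set decode_output_solution_codes(2))
next
  have "computable1 (\<lambda>r. solution_codes (code_bound r) r)"
    by (intro computable_compose2[OF computable_solution_codes] computable_code_bound
        computable_nth) simp
  then obtain algo where
    algo: "\<And>xs. length xs = 1 \<Longrightarrow> recf_eval algo xs (solution_codes (code_bound (xs ! 0)) (xs ! 0))"
    unfolding computable_def by blast
  have "recf_eval algo [r] (solution_codes (code_bound r) r)" for r
    using algo[of "[r]"] by simp
  then show "\<exists>algo. \<forall>r\<ge>2. \<exists>out. recf_eval algo [r] out \<and>
      distinct (decode_output out) \<and> set (decode_output out) = dioph_solutions_ge2 r"
    using decode_output_solution_codes by blast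
qed

end
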